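(* Let $\theta\in(0,\pi]$. If $\theta\in\mathbb{Q}\pi$ (i.e. $\theta = q\pi$ for some rational $q$), then $\theta$ does not have the bipartite detection property; that is, there exists a non-bipartite mixed graph having the $\theta$-symmetric spectrum.
   Context: A mixed graph $G=(V,\mathcal{A})$ consists of a finite vertex set $V$ and a set of arcs $\mathcal{A}\subseteq (V\times V)\setminus\{(x,x): x\in V\}$. Write $x\leftrightarrow y$ if $(x,y),(y,x)\in\mathcal A$, and $x\to y$ if $(x,y)\in\mathcal A$ but $(y,x)\notin\mathcal A$. The underlying graph $\Gamma(G)$ is the simple undirected graph on $V$ with edge $\{x,y\}$ whenever $(x,y)\in\mathcal A$ or $(y,x)\in\mathcal A$; $G$ is bipartite if $\Gamma(G)$ is bipartite. For $\theta\in(0,\pi]$, $H_\theta(G)\in\mathbb C^{V\times V}$ has $(x,y)$-entry $1$ if $x\leftrightarrow y$, $e^{i\theta}$ if $x\to y$, $e^{-i\theta}$ if $y\to x$, and $0$ otherwise. $G$ has the $\theta$-symmetric spectrum if the multiset of eigenvalues of $H_\theta(G)$ is invariant under $\lambda\mapsto-\lambda$ (with multiplicities). An angle $\theta$ has the bipartite detection property if for every mixed graph $G$: $G$ is bipartite iff $G$ has the $\theta$-symmetric spectrum. *)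

theory Defs
  imports
    Complex_Main
    "Jordan_Normal_Form.Char_Poly"
    "Graph_Theory.Digraph_Component"
begin

text \<open>
  A mixed graph is a finite loop-free digraph without parallel arcs, which is exactly the
  locale \<^locale>\<open>pair_digraph\<close>.  Its underlying simple undirected graph is, in the
  representation of undirected graphs used by that library (symmetric digraphs),
  \<^const>\<open>mk_symmetric\<close>.
\<close>

definition bipartite_graph :: "'a pair_pre_digraph \<Rightarrow> bool" where
  "bipartite_graph \<Gamma> \<longleftrightarrow> (\<exists>X Y. X \<union> Y = pverts \<Gamma> \<and> X \<inter> Y = {} \<and>
     (\<forall>(x, y) \<in> parcs \<Gamma>. (x \<in> X \<and> y \<in> Y) \<or> (x \<in> Y \<and> y \<in> X)))"

definition bipartite :: "'a pair_pre_digraph \<Rightarrow> bool" where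
  "bipartite G \<longleftrightarrow> bipartite_graph (mk_symmetric (with_proj G))"

definition H_entry :: "real \<Rightarrow> 'a pair_pre_digraph \<Rightarrow> 'a \<Rightarrow> 'a \<Rightarrow> complex" where
  "H_entry \<theta> G x y =
    (if (x, y) \<in> parcs G \<and> (y, x) \<in> parcs G then 1
     else if (x, y) \<in> parcs G then cis \<theta>
     else if (y, x) \<in> parcs G then cis (- \<theta>)
     else 0)"

text \<open>
  Rows and columns of the library's matrices are indexed by initial segments of the naturals, so
  the vertices are listed in increasing order.  Another order would conjugate the matrix by a
  permutation matrix and leave its spectrum unchanged.
\<close>

definition H_matrix :: "real \<Rightarrow> 'a::linorder pair_pre_digraph \<Rightarrow> complex mat" where
  "H_matrix \<theta> G =
    (let vs = sorted_list_of_set (pverts G); n = card (pverts G)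
     in mat n n (\<lambda>(i, j). H_entry \<theta> G (vs ! i) (vs ! j)))"

definition eigenvalue_mset :: "complex mat \<Rightarrow> complex multiset" where
  "eigenvalue_mset A = proots (char_poly A)"

definition symmetric_spectrum :: "real \<Rightarrow> 'a::linorder pair_pre_digraph \<Rightarrow> bool" where
  "symmetric_spectrum \<theta> G \<longleftrightarrow>
     image_mset uminus (eigenvalue_mset (H_matrix \<theta> G)) = eigenvalue_mset (H_matrix \<theta> G)"

text \<open>
  Quantifying over graphs whose vertices are natural numbers covers every finite mixed graph up to
  isomorphism.
\<close>

definition bipartite_detection :: "real \<Rightarrow> bool" where
  "bipartite_detection \<theta> \<longleftrightarrow>
     (\<forall>G :: nat pair_pre_digraph. pair_digraph G \<longrightarrow> (bipartite G \<longleftrightarrow> symmetric_spectrum \<theta> G))"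

end

theory Submission
  imports Defs "Jordan_Normal_Form.Jordan_Normal_Form_Existence" "HOL-Library.Nat_Bijection"
begin

text \<open>
  Choose \<open>m\<close> with \<open>cis \<theta> ^ m = 1\<close> and join two adjacent vertices by \<open>m\<close> further paths of equal even
  length, the \<open>j\<close>-th of total weight \<open>cis \<theta> ^ j\<close>.  Each of these paths closes up to an odd cycle, but
  since \<open>\<Sum>j<m. cis \<theta> ^ j = 0\<close> the paths do not couple their two ends: up to phases, the source
  sees only the constant mode of the bundle of paths and the sink only an orthogonal Fourier mode.
  In Fourier coordinates the matrix is therefore that of a disjoint union of weighted
  paths, which is bipartite, and a reflection \<open>S\<close> with \<open>S H = - H S\<close> can be written down explicitly.
\<close>

section \<open>Symmetric spectra from anticommuting involutions\<close>

text \<open>Similarity preserves the characteristic polynomial, while negating \<open>A\<close>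
  moves each root to its negative with the same order.\<close>

lemma eigenvalue_mset_symmetricI:
  assumes A: "A \<in> carrier_mat n n" and sim: "similar_mat A ((-1) \<cdot>\<^sub>m A)"
  shows "image_mset uminus (eigenvalue_mset A) = eigenvalue_mset A"
proof (rule multiset_eqI)
  fix x :: complex
  have nz: "char_poly A \<noteq> 0"
    using degree_monic_char_poly[OF A] by auto
  have "order (- x) (char_poly A) = order x (char_poly ((-1) \<cdot>\<^sub>m A))"
    using order_char_poly_smult[OF A, of "-1" x] by simp
  also have "\<dots> = order x (char_poly A)"
    using char_poly_similar[OF sim] by simp
  finally have ord: "order (- x) (char_poly A) = order x (char_poly A)" .
  have "uminus -` {x} = {- x}" by auto
  then have "count (image_mset uminus (eigenvalue_mset A)) x = count (eigenvalue_mset A) (- x)"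
    by (cases "- x \<in># eigenvalue_mset A") (auto simp: count_image_mset not_in_iff)
  then show "count (image_mset uminus (eigenvalue_mset A)) x = count (eigenvalue_mset A) x"
    using ord nz by (simp add: eigenvalue_mset_def)
qed

text \<open>An involution anticommuting with a matrix conjugates it to its negative. Indexing by an
  arbitrary finite set \<open>I\<close> keeps the sorted vertex list out of the later
  computations.\<close>

lemma symmetric_spectrumI:
  fixes enc :: "'b \<Rightarrow> 'a::linorder" and S :: "'b \<Rightarrow> 'b \<Rightarrow> complex"
  assumes fin: "finite I" and inj: "inj_on enc I" and verts: "pverts G = enc ` I"
    and inv: "\<And>x z. x \<in> I \<Longrightarrow> z \<in> I \<Longrightarrow> (\<Sum>y\<in>I. S x y * S y z) = (if x = z then 1 else 0)"
    and anti: "\<And>x z. x \<in> I \<Longrightarrow> z \<in> I \<Longrightarrow>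
      (\<Sum>y\<in>I. S x y * H_entry \<theta> G (enc y) (enc z)) = - (\<Sum>y\<in>I. H_entry \<theta> G (enc x) (enc y) * S y z)"
  shows "symmetric_spectrum \<theta> G"
proof -
  define n where "n = card (pverts G)"
  define vs where "vs = sorted_list_of_set (pverts G)"
  have finV: "finite (pverts G)" using fin verts by simp
  have "bij_betw ((!) vs) {..<n} (pverts G)"
    unfolding vs_def n_def by (rule bij_betw_nth) (simp_all add: finV)
  moreover have "bij_betw (inv_into I enc) (pverts G) I"
    using inj verts by (metis bij_betw_imageI bij_betw_inv_into)
  ultimately have bij: "bij_betw (inv_into I enc \<circ> (!) vs) {..<n} I"
    by (rule bij_betw_trans)
  define g where "g = inv_into I enc \<circ> (!) vs"
  have bij: "bij_betw g {..<n} I" using bij g_def by simp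
  have gI: "g i \<in> I" if "i < n" for i
    using bij that by (auto simp: bij_betw_def)
  have ginj: "g i = g j \<longleftrightarrow> i = j" if "i < n" "j < n" for i j
    using bij that by (auto simp: bij_betw_def inj_on_def)
  have enc_g: "enc (g i) = vs ! i" if "i < n" for i
  proof -
    have "vs ! i \<in> enc ` I"
      using that finV verts by (metis n_def nth_mem length_sorted_list_of_set set_sorted_list_of_set vs_def)
    then show ?thesis by (simp add: g_def f_inv_into_f)
  qed
  have sum_g: "(\<Sum>i = 0..<n. f (g i)) = (\<Sum>y\<in>I. f y)" for f :: "'b \<Rightarrow> complex"
    using sum.reindex_bij_betw[OF bij, of f] by (simp add: atLeast0LessThan)
  let ?A = "H_matrix \<theta> G"
  have A: "?A = mat n n (\<lambda>(i, j). H_entry \<theta> G (enc (g i)) (enc (g j)))"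
    unfolding H_matrix_def Let_def n_def[symmetric] vs_def[symmetric]
    by (rule eq_matI) (simp_all add: enc_g)
  have Ac: "?A \<in> carrier_mat n n" by (simp add: A)
  define T where "T = mat n n (\<lambda>(i, j). S (g i) (g j))"
  have Tc: "T \<in> carrier_mat n n" by (simp add: T_def)
  have TT: "T * T = 1\<^sub>m n"
    by (rule eq_matI)
      (simp_all add: T_def scalar_prod_def sum_g[of "\<lambda>y. S _ y * S y _"] inv gI ginj)
  have TA: "T * ?A = (-1) \<cdot>\<^sub>m (?A * T)"
    by (rule eq_matI)
      (simp_all add: A T_def scalar_prod_def
        sum_g[of "\<lambda>y. S _ y * H_entry \<theta> G (enc y) _"] sum_g[of "\<lambda>y. H_entry \<theta> G _ (enc y) * S y _"] anti gI)
  have "T * ((-1) \<cdot>\<^sub>m ?A) * T = (-1) \<cdot>\<^sub>m ((T * ?A) * T)"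
    using Ac Tc by (metis mult_smult_assoc_mat mult_smult_distrib mult_carrier_mat)
  also have "\<dots> = (-1) \<cdot>\<^sub>m ((-1) \<cdot>\<^sub>m (?A * T * T))"
    unfolding TA using Ac Tc by (metis mult_smult_assoc_mat mult_carrier_mat)
  also have "?A * T * T = ?A"
    using Ac Tc TT by (simp add: assoc_mult_mat[of _ n n _ n _ n])
  also have "(-1) \<cdot>\<^sub>m ((-1) \<cdot>\<^sub>m ?A) = ?A"
    by (rule eq_matI) simp_all
  finally have "similar_mat ?A ((-1) \<cdot>\<^sub>m ?A)"
    using Ac Tc TT by (intro similar_matI[of _ _ T T n]) auto
  then show ?thesis
    unfolding symmetric_spectrum_def by (rule eigenvalue_mset_symmetricI[OF Ac])
qed

lemma bipartite_colouring:
  assumes "bipartite G"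
  obtains X where "\<And>x y. (x, y) \<in> parcs G \<Longrightarrow> x \<in> X \<longleftrightarrow> y \<notin> X"
proof -
  from assms obtain X Y where "X \<inter> Y = {}"
    and "\<forall>(x, y) \<in> parcs (mk_symmetric (with_proj G)). (x \<in> X \<and> y \<in> Y) \<or> (x \<in> Y \<and> y \<in> X)"
    unfolding bipartite_def bipartite_graph_def by blast
  moreover have "(x, y) \<in> parcs (mk_symmetric (with_proj G))" if "(x, y) \<in> parcs G" for x y
    using that by (force simp: parcs_mk_symmetric)
  ultimately show ?thesis by (intro that[of X]) blast
qed

section \<open>The graph and its reflection\<close>

datatype vertex = Source | Sink | Cell nat nat

fun enc :: "vertex \<Rightarrow> nat" where
  "enc Source = 0"
| "enc Sink = 1"
| "enc (Cell j p) = prod_encode (j, p) + 2"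

lemma enc_eq_iff [simp]: "enc x = enc y \<longleftrightarrow> x = y"
  by (cases x; cases y) (auto simp: prod_encode_eq)

declare enc.simps [simp del]

text \<open>Any positive multiple of the order of \<open>cis \<theta>\<close> may serve as
  \<open>m\<close>; since \<open>cis \<theta>\<close> is not 1, its powers below \<open>m\<close>
  sum to 0.\<close>

locale parallel_paths =
  fixes \<theta> :: real and m :: nat
  assumes m_pos: "0 < m" and root_of_unity: "cis \<theta> ^ m = 1" and nontrivial: "cis \<theta> \<noteq> 1"
begin

text \<open>With \<open>2 * m + 1\<close> cells a path has an even number of edges and room for
  \<open>j < m\<close> one-way steps.\<close>

definition vertices :: "vertex set" where
  "vertices = {Source, Sink} \<union> (\<lambda>(j, p). Cell j p) ` ({..<m} \<times> {..2 * m})"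

text \<open>The step from position \<^term>\<open>p\<close> to \<^term>\<open>Suc p\<close> of path \<^term>\<open>j\<close> is one-way exactly
  if \<^term>\<open>p < j\<close>, so path \<^term>\<open>j\<close> has total weight \<^term>\<open>cis \<theta> ^ j\<close>.\<close>

fun arc :: "vertex \<Rightarrow> vertex \<Rightarrow> bool" where
  "arc Source Sink = True"
| "arc Sink Source = True"
| "arc Source (Cell j p) = (p = 0)"
| "arc (Cell j p) Source = (p = 0)"
| "arc Sink (Cell j p) = (p = 2 * m)"
| "arc (Cell j p) Sink = (p = 2 * m)"
| "arc (Cell j p) (Cell k q) = (j = k \<and> (q = Suc p \<or> p = Suc q \<and> j \<le> q))"
| "arc _ _ = False"

definition graph :: "nat pair_pre_digraph" where
  "graph = \<lparr>pverts = enc ` vertices,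
     parcs = {(enc x, enc y) | x y. x \<in> vertices \<and> y \<in> vertices \<and> arc x y}\<rparr>"

definition weight :: "vertex \<Rightarrow> vertex \<Rightarrow> complex" where
  "weight x y = H_entry \<theta> graph (enc x) (enc y)"

definition step :: "nat \<Rightarrow> nat \<Rightarrow> complex" where
  "step j p = (if p < j then cis \<theta> else 1)"

text \<open>The weight of path \<open>j\<close> from position \<open>p\<close> to the sink;
  truncated subtraction makes it 1 once \<open>p\<close> reaches \<open>j\<close>.\<close>

definition phase :: "nat \<Rightarrow> nat \<Rightarrow> complex" where
  "phase j p = cis \<theta> ^ (j - p)"

text \<open>The reflection \<open>D (1 - 2 P)\<close>, where \<open>P\<close> projects onto the span of the sink and of the
  vectors \<^term>\<open>\<lambda>j. phase j p\<close> at the levels \<^term>\<open>p\<close>, and \<open>D\<close> is the sign pattern \<open>(-1)\<^sup>p\<close> on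
  the cells and \<open>-1\<close> on the two ends.\<close>

fun refl :: "vertex \<Rightarrow> vertex \<Rightarrow> complex" where
  "refl Source Source = -1"
| "refl Sink Sink = 1"
| "refl (Cell j p) (Cell k q) =
    (if q = p then (-1) ^ p * ((if k = j then 1 else 0) - 2 / of_nat m * phase j p * cnj (phase k p)) else 0)"
| "refl _ _ = 0"

definition H_op :: "(vertex \<Rightarrow> complex) \<Rightarrow> vertex \<Rightarrow> complex" where
  "H_op f x = (\<Sum>y\<in>vertices. weight x y * f y)"

definition S_op :: "(vertex \<Rightarrow> complex) \<Rightarrow> vertex \<Rightarrow> complex" where
  "S_op f x = (\<Sum>y\<in>vertices. refl x y * f y)"

text \<open>The inner product with the phase vector of level \<open>p\<close>, which has squared
  norm \<open>m\<close>; hence the factor \<open>2 / of_nat m\<close> in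
  \<open>refl\<close>.\<close>

definition coord :: "(vertex \<Rightarrow> complex) \<Rightarrow> nat \<Rightarrow> complex" where
  "coord f p = (\<Sum>k<m. cnj (phase k p) * f (Cell k p))"

section \<open>Explicit formulas for the two operators\<close>

lemma finite_vertices: "finite vertices"
  by (simp add: vertices_def)

lemma vertices_simps [simp]:
  "Source \<in> vertices" "Sink \<in> vertices" "Cell j p \<in> vertices \<longleftrightarrow> j < m \<and> p \<le> 2 * m"
  by (auto simp: vertices_def)

lemma vertices_cases:
  assumes "x \<in> vertices"
  obtains "x = Source" | "x = Sink" | j p where "x = Cell j p" "j < m" "p \<le> 2 * m"
  using assms by (auto simp: vertices_def)

lemma sum_vertices:
  fixes f :: "vertex \<Rightarrow> complex"
  shows "(\<Sum>y\<in>vertices. f y) = f Source + f Sink + (\<Sum>j<m. \<Sum>p\<le>2 * m. f (Cell j p))"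
proof -
  let ?C = "(\<lambda>(j, p). Cell j p) ` ({..<m} \<times> {..2 * m})"
  have "(\<Sum>y\<in>vertices. f y) = (\<Sum>y\<in>{Source, Sink}. f y) + (\<Sum>y\<in>?C. f y)"
    unfolding vertices_def by (rule sum.union_disjoint) auto
  also have "(\<Sum>y\<in>?C. f y) = (\<Sum>(j, p)\<in>{..<m} \<times> {..2 * m}. f (Cell j p))"
    by (subst sum.reindex) (auto simp: inj_on_def intro!: sum.cong)
  also have "\<dots> = (\<Sum>j<m. \<Sum>p\<le>2 * m. f (Cell j p))"
    by (simp add: sum.cartesian_product)
  finally show ?thesis by simp
qed

lemma mem_parcs_graph [simp]:
  "(enc x, enc y) \<in> parcs graph \<longleftrightarrow> x \<in> vertices \<and> y \<in> vertices \<and> arc x y"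
  by (auto simp: graph_def)

lemma weight_ends:
  "weight Source Source = 0" "weight Sink Sink = 0"
  "weight Source Sink = 1" "weight Sink Source = 1"
  "j < m \<Longrightarrow> p \<le> 2 * m \<Longrightarrow> weight Source (Cell j p) = (if p = 0 then 1 else 0)"
  "j < m \<Longrightarrow> p \<le> 2 * m \<Longrightarrow> weight (Cell j p) Source = (if p = 0 then 1 else 0)"
  "j < m \<Longrightarrow> p \<le> 2 * m \<Longrightarrow> weight Sink (Cell j p) = (if p = 2 * m then 1 else 0)"
  "j < m \<Longrightarrow> p \<le> 2 * m \<Longrightarrow> weight (Cell j p) Sink = (if p = 2 * m then 1 else 0)"
  by (simp_all add: weight_def H_entry_def)

lemma weight_cells:
  "j < m \<Longrightarrow> p \<le> 2 * m \<Longrightarrow> k < m \<Longrightarrow> q \<le> 2 * m \<Longrightarrow> weight (Cell j p) (Cell k q) =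
    (if k = j then (if q = Suc p then step j p else 0) + (if p = Suc q then cnj (step j q) else 0) else 0)"
proof -
  assume "j < m" "p \<le> 2 * m" "k < m" "q \<le> 2 * m"
  moreover consider "q = Suc p" | "p = Suc q" | "q \<noteq> Suc p" "p \<noteq> Suc q" by blast
  ultimately show ?thesis
    by cases (simp_all add: weight_def H_entry_def step_def cis_cnj)
qed

lemmas weight_simps = weight_ends weight_cells

lemma H_op_ends:
  "H_op f Source = f Sink + (\<Sum>j<m. f (Cell j 0))"
  "H_op f Sink = f Source + (\<Sum>j<m. f (Cell j (2 * m)))"
  by (simp_all add: H_op_def sum_vertices weight_simps if_distrib[of "\<lambda>a. a * _"] sum.delta cong: if_cong)

lemma H_op_Cell:
  assumes "j < m" "p \<le> 2 * m"
  shows "H_op f (Cell j p) = (if p = 0 then f Source else 0) + (if p = 2 * m then f Sink else 0)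
    + (if p < 2 * m then step j p * f (Cell j (Suc p)) else 0)
    + (if 0 < p then cnj (step j (p - 1)) * f (Cell j (p - 1)) else 0)"
proof -
  have up: "(\<Sum>q\<le>2 * m. (if q = Suc p then step j p else 0) * f (Cell j q))
      = (if p < 2 * m then step j p * f (Cell j (Suc p)) else 0)"
    by (simp add: if_distrib[of "\<lambda>a. a * _"] sum.delta Suc_le_eq cong: if_cong)
  have down: "(\<Sum>q\<le>2 * m. (if p = Suc q then cnj (step j q) else 0) * f (Cell j q))
      = (if 0 < p then cnj (step j (p - 1)) * f (Cell j (p - 1)) else 0)"
    using assms by (cases p) (simp_all add: if_distrib[of "\<lambda>a. a * _"] sum.delta' cong: if_cong)
  have "(\<Sum>k<m. \<Sum>q\<le>2 * m. weight (Cell j p) (Cell k q) * f (Cell k q))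
    = (\<Sum>k<m. if k = j then
        (\<Sum>q\<le>2 * m. (if q = Suc p then step j p else 0) * f (Cell j q))
        + (\<Sum>q\<le>2 * m. (if p = Suc q then cnj (step j q) else 0) * f (Cell j q)) else 0)"
    unfolding sum.distrib[symmetric] distrib_right[symmetric]
    using assms by (intro sum.cong refl) (simp add: weight_simps cong: sum.cong_simp)
  also have "\<dots> = (if p < 2 * m then step j p * f (Cell j (Suc p)) else 0)
    + (if 0 < p then cnj (step j (p - 1)) * f (Cell j (p - 1)) else 0)"
    unfolding up down using assms by (simp add: sum.delta)
  finally show ?thesis
    using assms by (simp add: H_op_def sum_vertices weight_simps)
qed

lemma S_op_simps:
  "S_op f Source = - f Source"
  "S_op f Sink = f Sink"
  "j < m \<Longrightarrow> p \<le> 2 * m \<Longrightarrow>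
    S_op f (Cell j p) = (-1) ^ p * (f (Cell j p) - 2 / of_nat m * phase j p * coord f p)"
proof -
  show "S_op f Source = - f Source" "S_op f Sink = f Sink"
    by (simp_all add: S_op_def sum_vertices)
next
  assume jp: "j < m" "p \<le> 2 * m"
  have "S_op f (Cell j p) = (\<Sum>k<m. refl (Cell j p) (Cell k p) * f (Cell k p))"
    using jp by (simp add: S_op_def sum_vertices if_distrib[of "\<lambda>a. a * _"] sum.delta cong: if_cong)
  also have "\<dots> = (\<Sum>k<m. (if k = j then (-1) ^ p * f (Cell k p) else 0)
      - (-1) ^ p * (2 / of_nat m * phase j p) * (cnj (phase k p) * f (Cell k p)))"
    by (intro sum.cong refl) (simp add: algebra_simps)
  also have "\<dots> = (-1) ^ p * f (Cell j p) - (-1) ^ p * (2 / of_nat m * phase j p) * coord f p"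
    using jp unfolding coord_def sum_distrib_left by (simp add: sum_subtractf sum.delta)
  finally show "S_op f (Cell j p) = (-1) ^ p * (f (Cell j p) - 2 / of_nat m * phase j p * coord f p)"
    by (simp add: algebra_simps)
qed

section \<open>Phase vectors along the paths\<close>

lemma cnj_phase_mult: "cnj (phase j p) * phase j p = 1"
  by (simp add: phase_def cis_cnj power_mult_distrib[symmetric] cis_mult)

text \<open>Together with its conjugate forms below, this says that moving by one level maps phase
  vectors to phase vectors.\<close>

lemma step_phase: "step j p * phase j (Suc p) = phase j p"
proof (cases "p < j")
  case True
  then have "j - p = Suc (j - Suc p)" by simp
  then show ?thesis using True by (simp add: step_def phase_def)
qed (simp add: step_def phase_def)

lemma cnj_step_phase: "cnj (step j p) * phase j p = phase j (Suc p)"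
proof -
  have "cnj (step j p) * step j p = 1"
    by (simp add: step_def cis_cnj cis_mult)
  then have "cnj (step j p) * (step j p * phase j (Suc p)) = phase j (Suc p)"
    by (simp flip: mult.assoc)
  then show ?thesis by (simp only: step_phase)
qed

lemma cnj_phase_step: "cnj (phase j p) * step j p = cnj (phase j (Suc p))"
  by (metis cnj_step_phase complex_cnj_cnj complex_cnj_mult mult.commute)

lemma cnj_phase_cnj_step: "cnj (phase j (Suc p)) * cnj (step j p) = cnj (phase j p)"
  by (metis step_phase complex_cnj_mult mult.commute)

text \<open>The source meets level 0 in the constant vector, so this orthogonality decouples it from
  the phase vectors.\<close>

lemma sum_phase_0: "(\<Sum>j<m. phase j 0) = 0"
  using geometric_sum[OF nontrivial, of m] root_of_unity by (simp add: phase_def)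

lemma sum_cnj_phase_0: "(\<Sum>j<m. cnj (phase j 0)) = 0"
  using arg_cong[OF sum_phase_0, of cnj] by simp

text \<open>At the last level the phase vector is constant, so the sink couples to it alone.\<close>

lemma phase_last: "j < m \<Longrightarrow> phase j (2 * m) = 1"
  by (simp add: phase_def)

section \<open>Involution and anticommutation\<close>

lemma coord_S_op:
  assumes "p \<le> 2 * m"
  shows "coord (S_op f) p = - ((-1) ^ p * coord f p)"
proof -
  have "coord (S_op f) p = (\<Sum>k<m. (-1) ^ p * (cnj (phase k p) * f (Cell k p))
      - (-1) ^ p * (2 / of_nat m * coord f p) * (cnj (phase k p) * phase k p))"
    unfolding coord_def[of "S_op f"] using assms
    by (intro sum.cong refl) (simp add: S_op_simps algebra_simps)
  also have "\<dots> = (-1) ^ p * coord f p - of_nat m * ((-1) ^ p * (2 / of_nat m * coord f p))"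
    unfolding cnj_phase_mult by (simp add: sum_subtractf coord_def flip: sum_distrib_left)
  finally show ?thesis
    using m_pos by (simp add: algebra_simps)
qed

lemma S_op_S_op:
  assumes "x \<in> vertices"
  shows "S_op (S_op f) x = f x"
  using assms
proof (cases rule: vertices_cases)
  case (3 j p)
  then show ?thesis
    by (simp add: S_op_simps coord_S_op algebra_simps flip: power_add mult_2)
qed (simp_all add: S_op_simps)

text \<open>In phase coordinates the bundle collapses to a single path ending at the sink; the
  source term vanishes by \<open>sum_cnj_phase_0\<close>.\<close>

lemma coord_H_op:
  assumes "p \<le> 2 * m"
  shows "coord (H_op f) p = (if p = 2 * m then of_nat m * f Sink else 0)
    + (if p < 2 * m then coord f (Suc p) else 0) + (if 0 < p then coord f (p - 1) else 0)"
proof -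
  have "coord (H_op f) p = (\<Sum>k<m. (if p = 0 then cnj (phase k 0) * f Source else 0)
      + (if p = 2 * m then f Sink else 0)
      + (if p < 2 * m then cnj (phase k (Suc p)) * f (Cell k (Suc p)) else 0)
      + (if 0 < p then cnj (phase k (p - 1)) * f (Cell k (p - 1)) else 0))"
    unfolding coord_def
  proof (intro sum.cong refl)
    fix k assume "k \<in> {..<m}"
    then have k: "k < m" by simp
    have "cnj (phase k p) * cnj (step k (p - 1)) = cnj (phase k (p - 1))" if "0 < p"
      using that cnj_phase_cnj_step[of k "p - 1"] by simp
    moreover have "cnj (phase k p) * f Sink = f Sink" if "p = 2 * m"
      using that k by (simp add: phase_last)
    ultimately show "cnj (phase k p) * H_op f (Cell k p) = (if p = 0 then cnj (phase k 0) * f Source else 0)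
      + (if p = 2 * m then f Sink else 0)
      + (if p < 2 * m then cnj (phase k (Suc p)) * f (Cell k (Suc p)) else 0)
      + (if 0 < p then cnj (phase k (p - 1)) * f (Cell k (p - 1)) else 0)"
      unfolding H_op_Cell[OF k assms]
      by (auto simp: distrib_left cnj_phase_step simp flip: mult.assoc)
  qed
  also have "\<dots> = (if p = 2 * m then of_nat m * f Sink else 0)
    + (if p < 2 * m then coord f (Suc p) else 0) + (if 0 < p then coord f (p - 1) else 0)"
    using sum_cnj_phase_0 by (simp add: sum.distrib coord_def flip: sum_distrib_right)
  finally show ?thesis .
qed

text \<open>\<open>S_op\<close> has sign \<open>- ((-1) ^ p)\<close> on the phase vector of level
  \<open>p\<close>, \<open>(-1) ^ p\<close> on its complement, 1 on the sink and -1 on the source.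
  Every coupling in \<open>H_op\<close> joins opposite signs.\<close>

lemma S_op_H_op:
  assumes "x \<in> vertices"
  shows "S_op (H_op f) x = - H_op (S_op f) x"
  using assms
proof (cases rule: vertices_cases)
  case 1
  have "(\<Sum>j<m. S_op f (Cell j 0)) = (\<Sum>j<m. f (Cell j 0) - phase j 0 * (2 / of_nat m * coord f 0))"
    by (intro sum.cong refl) (simp add: S_op_simps)
  also have "\<dots> = (\<Sum>j<m. f (Cell j 0))"
    by (simp add: sum_subtractf sum_phase_0 flip: sum_distrib_right del: times_divide_eq_right times_divide_eq_left)
  finally show ?thesis
    using 1 by (simp add: S_op_simps H_op_ends)
next
  case 2
  have c: "coord f (2 * m) = (\<Sum>j<m. f (Cell j (2 * m)))"
    by (simp add: coord_def phase_last)
  have "(\<Sum>j<m. S_op f (Cell j (2 * m))) = (\<Sum>j<m. f (Cell j (2 * m)) - 2 / of_nat m * coord f (2 * m))"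
    by (intro sum.cong refl) (simp add: S_op_simps phase_last)
  also have "\<dots> = - (\<Sum>j<m. f (Cell j (2 * m)))"
    using m_pos by (simp add: sum_subtractf c)
  finally show ?thesis
    using 2 by (simp add: S_op_simps H_op_ends)
next
  case (3 j p)
  note jp = \<open>j < m\<close> \<open>p \<le> 2 * m\<close>
  let ?c = "2 / of_nat m * phase j p"
  let ?source = "if p = 0 then f Source else 0" and ?sink = "if p = 2 * m then f Sink else 0"
  let ?up = "if p < 2 * m then step j p * f (Cell j (Suc p)) else 0"
  let ?down = "if 0 < p then cnj (step j (p - 1)) * f (Cell j (p - 1)) else 0"
  let ?coord_up = "if p < 2 * m then coord f (Suc p) else 0"
  let ?coord_down = "if 0 < p then coord f (p - 1) else 0"
  have source: "(if p = 0 then S_op f Source else 0) = - ((-1) ^ p * ?source)"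
    by (simp add: S_op_simps)
  have sink: "(if p = 2 * m then S_op f Sink else 0) = (-1) ^ p * ?sink"
    by (simp add: S_op_simps)
  \<comment> \<open>Subtracting twice the sink term flips its sign, as anticommutation
    demands.\<close>
  have coord_sink: "?c * (if p = 2 * m then of_nat m * f Sink else 0) = 2 * ?sink"
    using jp m_pos by (simp add: phase_last)
  \<comment> \<open>The sign comes from the parity change between levels; \<open>step_phase\<close>
    brings the phase back to level \<open>p\<close>.\<close>
  have up: "(if p < 2 * m then step j p * S_op f (Cell j (Suc p)) else 0)
      = - ((-1) ^ p * (?up - ?c * ?coord_up))"
    using jp by (simp add: S_op_simps algebra_simps flip: step_phase[of j p])
  have down: "(if 0 < p then cnj (step j (p - 1)) * S_op f (Cell j (p - 1)) else 0)
      = - ((-1) ^ p * (?down - ?c * ?coord_down))"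
    using jp cnj_step_phase[of j "p - 1", symmetric]
    by (cases p) (simp_all add: S_op_simps algebra_simps)
  have "S_op (H_op f) (Cell j p)
      = (-1) ^ p * (?source + ?sink + ?up + ?down - (2 * ?sink + ?c * ?coord_up + ?c * ?coord_down))"
    unfolding S_op_simps(3)[OF jp] H_op_Cell[OF jp] coord_H_op[OF jp(2)] distrib_left[of ?c] coord_sink ..
  also have "\<dots> = - H_op (S_op f) (Cell j p)"
    unfolding H_op_Cell[OF jp] source sink up down by (simp add: algebra_simps split del: if_split)
  finally show ?thesis using 3 by simp
qed

section \<open>Properties of the graph\<close>

text \<open>Point masses extract columns, turning the operator identities into the entrywise ones
  that \<open>symmetric_spectrumI\<close> requires.\<close>

lemma sum_vertices_delta:
  assumes "z \<in> vertices"
  shows "S_op (\<lambda>y. if y = z then 1 else 0) = (\<lambda>x. refl x z)"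
    and "H_op (\<lambda>y. if y = z then 1 else 0) = (\<lambda>x. weight x z)"
  using assms finite_vertices
  by (auto simp: fun_eq_iff S_op_def H_op_def if_distrib[of "\<lambda>a. _ * a"] cong: if_cong)

lemma symmetric_spectrum_graph: "symmetric_spectrum \<theta> graph"
proof (rule symmetric_spectrumI[where I = vertices and enc = enc and S = refl])
  show "finite vertices" by (rule finite_vertices)
  show "inj_on enc vertices" by (simp add: inj_on_def)
  show "pverts graph = enc ` vertices" by (simp add: graph_def)
next
  fix x z assume x: "x \<in> vertices" and z: "z \<in> vertices"
  show "(\<Sum>y\<in>vertices. refl x y * refl y z) = (if x = z then 1 else 0)"
    using S_op_S_op[OF x, of "\<lambda>y. if y = z then 1 else 0"]
    unfolding sum_vertices_delta[OF z] unfolding S_op_def .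
  show "(\<Sum>y\<in>vertices. refl x y * H_entry \<theta> graph (enc y) (enc z))
      = - (\<Sum>y\<in>vertices. H_entry \<theta> graph (enc x) (enc y) * refl y z)"
    using S_op_H_op[OF x, of "\<lambda>y. if y = z then 1 else 0"]
    unfolding sum_vertices_delta[OF z] unfolding S_op_def H_op_def weight_def .
qed

lemma pair_digraph_graph: "pair_digraph graph"
proof
  show "finite (pverts graph)" by (simp add: graph_def finite_vertices)
  have "parcs graph \<subseteq> enc ` vertices \<times> enc ` vertices" by (auto simp: graph_def)
  then show "finite (parcs graph)" by (rule finite_subset) (simp add: finite_vertices)
  have "\<not> arc x x" for x by (cases x) auto
  then show "fst e \<noteq> snd e" if "e \<in> parcs graph" for e
    using that by (auto simp: graph_def)
qed (auto simp: graph_def)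

lemma not_bipartite_graph: "\<not> bipartite graph"
proof
  assume "bipartite graph"
  then obtain X where "\<And>x y. (x, y) \<in> parcs graph \<Longrightarrow> x \<in> X \<longleftrightarrow> y \<notin> X"
    using bipartite_colouring by blast
  then have X: "enc x \<in> X \<longleftrightarrow> enc y \<notin> X" if "x \<in> vertices" "y \<in> vertices" "arc x y" for x y
    using that by simp
  \<comment> \<open>Colours alternate along path 0, so its even length gives both ends the same
    colour, against the edge joining them.\<close>
  have "enc (Cell 0 p) \<in> X \<longleftrightarrow> (enc Source \<in> X \<longleftrightarrow> odd p)" if "p \<le> 2 * m" for p
    using that
  proof (induction p)
    case 0
    then show ?case using X[of Source "Cell 0 0"] m_pos by auto
  next
    case (Suc p)
    then show ?case using X[of "Cell 0 p" "Cell 0 (Suc p)"] m_pos by auto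
  qed
  from this[of "2 * m"] show False
    using X[of Source Sink] X[of Sink "Cell 0 (2 * m)"] m_pos by auto
qed

end

section \<open>Rational multiples of pi\<close>

lemma parallel_paths_rational_angle:
  assumes "0 < \<theta>" "\<theta> \<le> pi" "q \<in> \<rat>" "\<theta> = q * pi"
  shows "\<exists>m. parallel_paths \<theta> m"
proof -
  from \<open>q \<in> \<rat>\<close> obtain a :: int and b :: nat where b: "b > 0" and q: "q = of_int a / of_nat b"
    by (metis Rats_cases' of_int_of_nat_eq of_nat_0_less_iff pos_int_cases)
  \<comment> \<open>Doubling the denominator yields a multiple of \<open>2 * pi\<close> even for odd
    \<open>a\<close>.\<close>
  have "real (2 * b) * \<theta> = 2 * pi * of_int a"
    using b by (simp add: q assms(4))
  then have "cis \<theta> ^ (2 * b) = 1"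
    by (simp add: DeMoivre cis_multiple_2pi del: of_nat_mult)
  moreover have "cis \<theta> \<noteq> 1"
  proof
    assume "cis \<theta> = 1"
    \<comment> \<open>The cosine is strictly decreasing on the interval from 0 to \<open>pi\<close>,
      so it cannot return to its value at 0.\<close>
    then have "cos \<theta> = cos 0" by (metis cis.sel(1) cos_zero one_complex.sel(1))
    then show False using cos_monotone_0_pi[of 0 \<theta>] assms(1,2) by simp
  qed
  ultimately have "parallel_paths \<theta> (2 * b)"
    using b by unfold_locales simp_all
  then show ?thesis ..
qed

theorem theorem1p3:
  fixes \<theta> :: real
  assumes "0 < \<theta>" and "\<theta> \<le> pi"
    and "\<exists>q\<in>\<rat>. \<theta> = q * pi"
  shows "\<not> bipartite_detection \<theta> \<and>
    (\<exists>G :: nat pair_pre_digraph. pair_digraph G \<and> \<not> bipartite G \<and> symmetric_spectrum \<theta> G)"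
proof -
  obtain m where "parallel_paths \<theta> m"
    using parallel_paths_rational_angle assms by blast
  then interpret parallel_paths \<theta> m .
  show ?thesis
    using pair_digraph_graph not_bipartite_graph symmetric_spectrum_graph
    unfolding bipartite_detection_def by blast
qed

end
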